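(* Let $v\in C^0([0,T],\mathbb{R}_{>0})$. Then there exists $c>0$ such that for any $n\ge1$ and any $\boldsymbol\delta=(\boldsymbol h,\boldsymbol t,\boldsymbol\rho)\in\aleph_n$, $$c\,(\min_i\rho_i)^{-d_R-d_F/2}\le\Delta C(\boldsymbol\delta;v;\arg\min_i\rho_i).$$ In particular, $\Delta C(\boldsymbol\delta;v;\arg\min_i\rho_i)>0$ for all $n\ge1$ and $\boldsymbol\delta\in\aleph_n$.
   Context: Constants $L,P,T>0$ are fixed; $\|\cdot\|_\infty$ is the max norm. For $n\ge1$, $\aleph_n$ is the set of all $\boldsymbol\delta=(\boldsymbol h,\boldsymbol t,\boldsymbol\rho)$ with $\boldsymbol h=(h_1,\ldots,h_n)\in\mathbb{R}^n_{>0}$, $\boldsymbol t=(t_0,\ldots,t_n)$, $\boldsymbol\rho=(\rho_0,\ldots,\rho_n)\in\mathbb{R}^{n+1}_{>0}$ such that $t_k=\sum_{j=1}^kh_j$ for $0\le k\le n$, $t_n=T$, $\|\boldsymbol h\|_\infty\le\frac1{4L}$, $\|\boldsymbol\rho\|_\infty\le\frac P{8L}$, $\rho_j/\rho_k\in\{4^\ell:\ell\in\mathbb{Z}\}$ for all $j,k\in\{0,\ldots,n\}$, and $\rho_j=2LPh_j^2$ for all $j\in\{1,\ldots,n\}$. $\aleph:=\bigcup_{n\ge1}\aleph_n$. Subdivision rule: $\psi[\boldsymbol\delta;0]:=(\boldsymbol h,\boldsymbol t,(\rho_0/4,\rho_1,\ldots,\rho_n))$. For $j\in\{1,\ldots,n\}$,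 $\psi[\boldsymbol\delta;j]$ has components $(h_1,\ldots,h_{j-1},h_j/2,h_j/2,h_{j+1},\ldots,h_n)$, $(t_0,\ldots,t_{j-1},t_j-h_j/2,t_j,t_{j+1},\ldots,t_n)$, $(\rho_0,\ldots,\rho_{j-1},\rho_j/4,\rho_j/4,\rho_{j+1},\ldots,\rho_n)$. Dimensions: consider the differential inclusion $\dot x(t)\in F(x(t))$ a.e. in $(0,T)$, $x(0)\in X_0$, in $\mathbb{R}^d$, with $X_0$ nonempty, compact and path-connected and $F$ an $L$-Lipschitz (Hausdorff distance, max norm) map with nonempty compact convex values bounded by $P$; let $\mathcal{R}^F(t)$ be its reachable set at time $t$. Then $d_R:=\min(d-1,\max_{t\in[0,T]}\dim\mathcal{R}^F(t))$ and $d_F:=\min(d-1,\max_{t\in[0,T]}\max_{x\in\mathcal{R}^F(t)}\dim F(x))$; it is assumed that $d_R\ge1$. They enter the claim only as fixed integers $d_R\ge1$, $d_F\ge0$. Cost function: $\sigma(h,\rho):=\frac\rho4(1+Lh)\big(\frac{1+Lh}{1-Lh}+6\big)$ and $$C(\boldsymbol\delta;v):=\sum_{k=0}^{n-1}\frac{4v(t_k)h_{k+1}^{d_F}}{\rho_k^{d_R}\min(\rho_k,\rho_{k+1})^{d_F+1}}\,\sigma(h_{k+1},\rho_k),\qquad \Delta C(\boldsymbol\delta;v;j):=C(\psi[\boldsymbol\delta;j];v)-C(\boldsymbol\delta;v).$$ Convention: $\arg\min_i\rho_i$ denotes any index $k\in\{0,\ldots,n\}$ with $\rho_k=\min_i\rho_i$;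 the claim is meant for every such index. *)

theory Defs
  imports Complex_Main
begin

text \<open>
  A discretization is a triple of finite tuples
  \<open>h = (h\<^sub>1, \<dots>, h\<^sub>n)\<close>, \<open>t = (t\<^sub>0, \<dots>, t\<^sub>n)\<close>, \<open>\<rho> = (\<rho>\<^sub>0, \<dots>, \<rho>\<^sub>n)\<close>,
  represented by lists of lengths \<open>n\<close>, \<open>n + 1\<close>, \<open>n + 1\<close>.
  As list positions start at 0, \<open>t\<^sub>k\<close> is \<open>t ! k\<close> and \<open>\<rho>\<^sub>k\<close> is \<open>\<rho> ! k\<close>,
  but \<open>h\<^sub>k\<close> is \<open>h ! (k - 1)\<close>.
\<close>

type_synonym disc = "real list \<times> real list \<times> real list"

definition max_norm :: "real list \<Rightarrow> real" where
  "max_norm xs = Max (abs ` set xs)"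

definition aleph :: "real \<Rightarrow> real \<Rightarrow> real \<Rightarrow> nat \<Rightarrow> disc set" where
  "aleph L P T n = {(h, t, \<rho>).
     length h = n \<and> length t = n + 1 \<and> length \<rho> = n + 1 \<and>
     (\<forall>x\<in>set h. x > 0) \<and> (\<forall>x\<in>set \<rho>. x > 0) \<and>
     (\<forall>k\<in>{0..n}. t ! k = (\<Sum>j=1..k. h ! (j - 1))) \<and>
     t ! n = T \<and>
     max_norm h \<le> 1 / (4 * L) \<and>
     max_norm \<rho> \<le> P / (8 * L) \<and>
     (\<forall>j\<in>{0..n}. \<forall>k\<in>{0..n}. \<rho> ! j / \<rho> ! k \<in> {4 powi l |l :: int. True}) \<and>
     (\<forall>j\<in>{1..n}. \<rho> ! j = 2 * L * P * (h ! (j - 1))\<^sup>2)}"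

text \<open>
  The subdivision rule, meaningful for \<open>j \<in> {0..n}\<close>. For \<open>j \<ge> 1\<close> the three tuples
  each grow by one entry.
\<close>

definition subdivide :: "disc \<Rightarrow> nat \<Rightarrow> disc" where
  "subdivide \<delta> j = (case \<delta> of (h, t, \<rho>) \<Rightarrow>
     if j = 0 then (h, t, \<rho>[0 := \<rho> ! 0 / 4])
     else
       (take (j - 1) h @ [h ! (j - 1) / 2, h ! (j - 1) / 2] @ drop j h,
        take j t @ [t ! j - h ! (j - 1) / 2] @ drop j t,
        take j \<rho> @ [\<rho> ! j / 4, \<rho> ! j / 4] @ drop (j + 1) \<rho>))"

definition sigma :: "real \<Rightarrow> real \<Rightarrow> real \<Rightarrow> real" where
  "sigma L h \<rho> = \<rho> / 4 * (1 + L * h) * ((1 + L * h) / (1 - L * h) + 6)"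

text \<open>In the summand, \<open>h ! k\<close> is \<open>h\<^bsub>k+1\<^esub>\<close>.\<close>

definition cost :: "real \<Rightarrow> nat \<Rightarrow> nat \<Rightarrow> disc \<Rightarrow> (real \<Rightarrow> real) \<Rightarrow> real" where
  "cost L dR dF \<delta> v = (case \<delta> of (h, t, \<rho>) \<Rightarrow>
     \<Sum>k<length h.
       4 * v (t ! k) * (h ! k) ^ dF
         / ((\<rho> ! k) ^ dR * (min (\<rho> ! k) (\<rho> ! (k + 1))) ^ (dF + 1))
         * sigma L (h ! k) (\<rho> ! k))"

definition delta_cost ::
    "real \<Rightarrow> nat \<Rightarrow> nat \<Rightarrow> disc \<Rightarrow> (real \<Rightarrow> real) \<Rightarrow> nat \<Rightarrow> real" where
  "delta_cost L dR dF \<delta> v j = cost L dR dF (subdivide \<delta> j) v - cost L dR dF \<delta> v"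

end

theory Submission
  imports Defs
begin

text \<open>
  Write \<open>\<sigma>(h, \<rho>) = \<rho>/4 \<sqdot> g(Lh)\<close>. On \<open>0 \<le> Lh \<le> 1/4\<close> the factor \<open>g\<close> lies between
  7 and \<open>115/12\<close>. Let \<open>\<rho>\<^sub>j\<close> be minimal.
  If \<open>j = 0\<close>, only the first summand changes, and it is multiplied by
  \<open>4^(d\<^sub>R + d\<^sub>F) \<ge> 4\<close>. If \<open>j \<ge> 1\<close>, the summand of the interval to the right of \<open>t\<^sub>j\<close>
  is multiplied by \<open>4^(d\<^sub>R + d\<^sub>F)\<close>, the left half of the split interval alone costs at
  least as much as the whole interval did, because it gains a factor
  \<open>2^(d\<^sub>F + 2) g(Lh\<^sub>j/2)/g(Lh\<^sub>j) > 1\<close>, and the right half is a surplus.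
  In both cases the gain dominates a single summand in which
  \<open>h \<ge> (\<rho>/(2LP))^(1/2)\<close>; this inequality turns \<open>h^d\<^sub>F / \<rho>^(d\<^sub>R + d\<^sub>F)\<close> into the
  claimed power of \<open>\<rho>\<close>.
\<close>

section \<open>Bounds on the factor \<open>g\<close>, here \<open>sigma_factor\<close>\<close>

definition sigma_factor :: "real \<Rightarrow> real" where
  "sigma_factor x = (1 + x) * ((1 + x) / (1 - x) + 6)"

lemma sigma_eq: "sigma L h r = r / 4 * sigma_factor (L * h)"
  by (simp add: sigma_def sigma_factor_def)

lemma sigma_factor_ge:
  assumes "0 \<le> x" "x \<le> 1 / 4"
  shows "7 \<le> sigma_factor x"
proof -
  have "1 \<le> (1 + x) / (1 - x)"
    using assms by (simp add: field_simps)
  then have "1 * 7 \<le> (1 + x) * ((1 + x) / (1 - x) + 6)"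
    using assms by (intro mult_mono) auto
  then show ?thesis
    by (simp add: sigma_factor_def)
qed

lemma sigma_factor_le:
  assumes "0 \<le> x" "x \<le> 1 / 4"
  shows "sigma_factor x \<le> 115 / 12"
proof -
  have "(1 + x) / (1 - x) \<le> 5 / 3"
    using assms by (simp add: field_simps)
  moreover have "0 \<le> (1 + x) / (1 - x)"
    using assms by simp
  \<comment> \<open>Both factors increase in \<open>x\<close>; the bounds are their values at
    \<open>x = 1 / 4\<close>.\<close>
  ultimately have "(1 + x) * ((1 + x) / (1 - x) + 6) \<le> (5 / 4) * (23 / 3)"
    using assms by (intro mult_mono) auto
  then show ?thesis
    by (simp add: sigma_factor_def)
qed

section \<open>A single summand of the cost under refinement\<close>

text \<open>\<open>w\<close> is the value of \<open>v\<close> at the left node of an interval of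
  length \<open>h\<close>; \<open>r\<close> and \<open>s\<close> are the values of
  \<open>\<rho>\<close> at its left and right node.\<close>

definition cost_term ::
    "real \<Rightarrow> nat \<Rightarrow> nat \<Rightarrow> real \<Rightarrow> real \<Rightarrow> real \<Rightarrow> real \<Rightarrow> real" where
  "cost_term L dR dF w h r s =
     4 * w * h ^ dF / (r ^ dR * (min r s) ^ (dF + 1)) * sigma L h r"

lemma cost_eq_sum_cost_term:
  "cost L dR dF (h, t, \<rho>) v =
     (\<Sum>k<length h. cost_term L dR dF (v (t ! k)) (h ! k) (\<rho> ! k) (\<rho> ! Suc k))"
  by (simp add: cost_def cost_term_def)

lemma cost_term_pos:
  assumes "0 < w" "0 < h" "0 \<le> L * h" "L * h \<le> 1 / 4" "0 < r" "0 < s"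
  shows "0 < cost_term L dR dF w h r s"
proof -
  have "0 < sigma_factor (L * h)"
    using sigma_factor_ge[of "L * h"] assms by linarith
  then show ?thesis
    using assms by (simp add: cost_term_def sigma_eq)
qed

text \<open>The minimum is \<open>r\<close>, and the factor \<open>r\<close> in \<open>sigma\<close>
  cancels one of the \<open>dR + dF + 1\<close> powers.\<close>

lemma cost_term_of_le:
  assumes "0 < r" "r \<le> s"
  shows "cost_term L dR dF w h r s = w * h ^ dF * sigma_factor (L * h) / r ^ (dR + dF)"
  using assms by (simp add: cost_term_def sigma_eq min_absorb1 power_add field_simps)

lemma cost_term_quarter:
  assumes "0 < r" "r \<le> s" "r / 4 \<le> s'"
  shows "cost_term L dR dF w h (r / 4) s' = 4 ^ (dR + dF) * cost_term L dR dF w h r s"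
  using assms by (simp add: cost_term_of_le power_divide)

text \<open>Halving \<open>h\<close> costs \<open>2 ^ dF\<close>, quartering the minimum
  \<open>s\<close> gains \<open>4 ^ (dF + 1)\<close>. The net factor \<open>4 * 2 ^ dF\<close>
  outweighs the change of \<open>sigma_factor\<close>, since \<open>4 * 7\<close> exceeds
  \<open>115 / 12\<close>.\<close>

lemma cost_term_halve_ge:
  assumes "0 < w" "0 < h" "0 \<le> L * h" "L * h \<le> 1 / 4" "0 < s" "s \<le> r"
  shows "cost_term L dR dF w h r s \<le> cost_term L dR dF w (h / 2) r (s / 4)"
proof -
  define A where "A = w * h ^ dF * r / (r ^ dR * s ^ (dF + 1))"
  have "0 \<le> A"
    using assms by (simp add: A_def)
  have whole: "cost_term L dR dF w h r s = A * sigma_factor (L * h)"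
    using assms by (simp add: A_def cost_term_def sigma_eq min_absorb2)
  have half: "cost_term L dR dF w (h / 2) r (s / 4) =
      A * (2 ^ dF * 4 * sigma_factor (L * (h / 2)))"
  proof -
    have "(4::real) ^ dF = 2 ^ dF * 2 ^ dF"
      by (simp flip: power_mult_distrib)
    then show ?thesis
      using assms
      by (simp add: A_def cost_term_def sigma_eq min_absorb2 power_divide field_simps)
  qed
  have "sigma_factor (L * h) \<le> 115 / 12"
    using assms by (intro sigma_factor_le)
  also have "\<dots> \<le> 1 * 4 * 7"
    by simp
  also have "\<dots> \<le> 2 ^ dF * 4 * sigma_factor (L * (h / 2))"
    using assms by (intro mult_mono sigma_factor_ge) auto
  finally show ?thesis
    unfolding whole half using \<open>0 \<le> A\<close> by (rule mult_left_mono)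
qed

lemma cost_term_lower_bound:
  assumes "0 < m" "m \<le> w" "0 < h" "0 \<le> L * h" "L * h \<le> 1 / 4"
    and "0 < r" "r \<le> s" "0 < K" "r \<le> K * h\<^sup>2"
  shows "m * K powr (- real dF / 2) * r powr (- real dR - real dF / 2)
           \<le> cost_term L dR dF w h r s"
proof -
  have "K powr (- real dF / 2) * r powr (real dF / 2) = (r / K) powr (real dF / 2)"
    using assms by (simp add: powr_divide powr_minus_divide)
  also have "\<dots> \<le> (h\<^sup>2) powr (real dF / 2)"
    using assms by (intro powr_mono2) (auto simp: field_simps)
  also have "(h\<^sup>2) powr (real dF / 2) = (h powr 2) powr (real dF / 2)"
    using assms by simp
  also have "\<dots> = h powr real dF"
    unfolding powr_powr by simp
  also have "\<dots> = h ^ dF"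
    using assms by (intro powr_realpow)
  finally have h: "K powr (- real dF / 2) * r powr (real dF / 2) \<le> h ^ dF" .
  \<comment> \<open>The power \<open>r powr (dF / 2)\<close> split off here is the one absorbed by
    \<open>h ^ dF\<close>.\<close>
  have "r powr (- real dR - real dF / 2) =
      r powr (real dF / 2) * r powr (- real (dR + dF))"
    unfolding powr_add[symmetric] by (rule arg_cong) simp
  also have "r powr (- real (dR + dF)) = 1 / r ^ (dR + dF)"
    using assms by (subst powr_minus_divide, subst powr_realpow) auto
  finally have "m * K powr (- real dF / 2) * r powr (- real dR - real dF / 2) =
      m * (K powr (- real dF / 2) * r powr (real dF / 2)) * 1 / r ^ (dR + dF)"
    by simp
  also have "\<dots> \<le> w * h ^ dF * sigma_factor (L * h) / r ^ (dR + dF)"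
  proof (intro divide_right_mono mult_mono h)
    show "1 \<le> sigma_factor (L * h)"
      using sigma_factor_ge[of "L * h"] assms by linarith
  qed (use assms in auto)
  also have "\<dots> = cost_term L dR dF w h r s"
    using assms by (simp add: cost_term_of_le)
  finally show ?thesis .
qed

text \<open>\<open>f\<close> lists the old summands, \<open>g\<close> those after summand
  \<open>i\<close> is split in two: later positions move by one, and \<open>g (Suc i)\<close> has no
  old counterpart.\<close>

lemma sum_insert_index_le:
  fixes f g :: "nat \<Rightarrow> real"
  assumes "i < n"
    and "\<And>k. k \<le> i \<Longrightarrow> f k \<le> g k"
    and "\<And>k. i < k \<Longrightarrow> k < n \<Longrightarrow> f k \<le> g (Suc k)"
  shows "(\<Sum>k<n. f k) + g (Suc i) \<le> (\<Sum>k<Suc n. g k)"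
  using assms(1,3)
proof (induction n)
  case (Suc n)
  show ?case
  proof (cases "i = n")
    case True
    have "(\<Sum>k<Suc n. f k) \<le> (\<Sum>k<Suc n. g k)"
      using assms(2) True by (intro sum_mono) auto
    then show ?thesis
      using True by simp
  next
    case False
    have "(\<Sum>k<n. f k) + g (Suc i) \<le> (\<Sum>k<Suc n. g k)"
      using Suc.prems False by (intro Suc.IH) auto
    moreover have "f n \<le> g (Suc n)"
      using Suc.prems False by auto
    ultimately show ?thesis
      by simp
  qed
qed simp

section \<open>Properties of a fixed discretization\<close>

context
  fixes L P T :: real and n :: nat and h t \<rho> :: "real list"
  assumes L: "0 < L"
    and in_aleph: "(h, t, \<rho>) \<in> aleph L P T n"
begin

lemma aleph_lengths: "length h = n" "length t = n + 1" "length \<rho> = n + 1"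
  using in_aleph by (auto simp: aleph_def)

lemma aleph_h_pos: "k < n \<Longrightarrow> 0 < h ! k"
  using in_aleph by (auto simp: aleph_def)

lemma aleph_rho_pos: "k \<le> n \<Longrightarrow> 0 < \<rho> ! k"
  using in_aleph by (auto simp: aleph_def)

lemma aleph_Lh:
  assumes "k < n"
  shows "0 \<le> L * h ! k" "L * h ! k \<le> 1 / 4"
proof -
  show "0 \<le> L * h ! k"
    using L aleph_h_pos[OF assms] by simp
  have "\<bar>h ! k\<bar> \<le> max_norm h"
    unfolding max_norm_def using assms aleph_lengths by (intro Max_ge) auto
  also have "\<dots> \<le> 1 / (4 * L)"
    using in_aleph by (simp add: aleph_def)
  finally show "L * h ! k \<le> 1 / 4"
    using L by (simp add: field_simps abs_le_iff)
qed

lemma aleph_rho_Suc: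
  assumes "k < n"
  shows "\<rho> ! Suc k = 2 * L * P * (h ! k)\<^sup>2"
proof -
  have "\<forall>j\<in>{1..n}. \<rho> ! j = 2 * L * P * (h ! (j - 1))\<^sup>2"
    using in_aleph by (simp add: aleph_def)
  from bspec[OF this, of "Suc k"] show ?thesis
    using assms by simp
qed

lemma aleph_t: "k \<le> n \<Longrightarrow> t ! k = (\<Sum>j=1..k. h ! (j - 1))"
  using in_aleph by (simp add: aleph_def)

lemma aleph_t_Suc: "k < n \<Longrightarrow> t ! Suc k = t ! k + h ! k"
  by (simp add: aleph_t)

text \<open>Needed because \<open>v\<close> is controlled only on \<open>{0..T}\<close>.\<close>

lemma aleph_t_mem:
  assumes "k \<le> n"
  shows "t ! k \<in> {0..T}"
proof -
  have nonneg: "0 \<le> h ! (j - 1)" if "j \<in> {1..n}" for j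
    using that less_imp_le[OF aleph_h_pos[of "j - 1"]] by auto
  have "0 \<le> t ! k"
    unfolding aleph_t[OF assms] using assms by (intro sum_nonneg nonneg) auto
  moreover have "t ! k \<le> t ! n"
    unfolding aleph_t[OF assms] aleph_t[OF order_refl]
    using assms by (intro sum_mono2 nonneg) auto
  moreover have "t ! n = T"
    using in_aleph by (simp add: aleph_def)
  ultimately show ?thesis
    by simp
qed

text \<open>This is the node created by subdivision, midway between \<open>t ! k\<close> and
  \<open>t ! Suc k\<close>.\<close>

lemma aleph_midpoint_mem:
  assumes "k < n"
  shows "t ! Suc k - h ! k / 2 \<in> {0..T}"
  using aleph_t_mem[of k] aleph_t_mem[of "Suc k"] aleph_t_Suc aleph_h_pos assms by force

section \<open>Cost increase at a node of minimal \<open>\<rho>\<close>\<close>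

lemma delta_cost_zero_ge:
  fixes v :: "real \<Rightarrow> real"
  assumes "1 \<le> n" "1 \<le> dR" "0 < v (t ! 0)" "\<rho> ! 0 \<le> \<rho> ! 1"
  shows "cost_term L dR dF (v (t ! 0)) (h ! 0) (\<rho> ! 0) (\<rho> ! 1)
           \<le> delta_cost L dR dF (h, t, \<rho>) v 0"
proof -
  define c where "c = cost_term L dR dF (v (t ! 0)) (h ! 0) (\<rho> ! 0) (\<rho> ! 1)"
  obtain m where m: "n = Suc m"
    using assms(1) by (cases n) auto
  have pos: "0 < \<rho> ! 0" "0 < \<rho> ! 1"
    using aleph_rho_pos assms(1) by auto
  have "0 \<le> c"
    unfolding c_def using assms pos aleph_h_pos[of 0] aleph_Lh[of 0]
    by (intro less_imp_le[OF cost_term_pos]) auto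
  have "delta_cost L dR dF (h, t, \<rho>) v 0 = 4 ^ (dR + dF) * c - c"
    using assms pos aleph_lengths cost_term_quarter[of "\<rho> ! 0" "\<rho> ! 1" "\<rho> ! 1" L dR dF]
    by (simp add: delta_cost_def subdivide_def cost_eq_sum_cost_term m c_def
        sum.lessThan_Suc_shift del: sum.lessThan_Suc)
  \<comment> \<open>As \<open>dR\<close> is at least 1, the gain is at least
    \<open>3 * c\<close>.\<close>
  moreover have "4 * c \<le> 4 ^ (dR + dF) * c"
    using assms \<open>0 \<le> c\<close> power_increasing[of 1 "dR + dF" "4::real"]
    by (intro mult_right_mono) auto
  ultimately show ?thesis
    unfolding c_def[symmetric] using \<open>0 \<le> c\<close> by linarith
qed

text \<open>The bounding term is the right half of the split interval, whose end nodes both carry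
  the quartered value.\<close>

lemma delta_cost_Suc_ge:
  fixes v :: "real \<Rightarrow> real"
  assumes i: "i < n"
    and v: "\<And>s. s \<in> {0..T} \<Longrightarrow> 0 < v s"
    and min: "\<And>k. k \<le> n \<Longrightarrow> \<rho> ! Suc i \<le> \<rho> ! k"
  shows "cost_term L dR dF (v (t ! Suc i - h ! i / 2)) (h ! i / 2)
             (\<rho> ! Suc i / 4) (\<rho> ! Suc i / 4)
           \<le> delta_cost L dR dF (h, t, \<rho>) v (Suc i)"
proof -
  obtain h' t' \<rho>' where sub: "subdivide (h, t, \<rho>) (Suc i) = (h', t', \<rho>')"
    by (metis prod_cases3)
  note sub_eqs = sub[unfolded subdivide_def, simplified]
  have len: "length h' = Suc n"
    using sub_eqs i aleph_lengths by auto
  \<comment> \<open>Entrywise form of the subdivision; behind the inserted entries positions move by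
    one, hence \<open>k - 1\<close>.\<close>
  have h': "h' ! k = (if k < i then h ! k else if k \<le> Suc i then h ! i / 2 else h ! (k - 1))"
    if "k \<le> n" for k
    using sub_eqs i that aleph_lengths
    by (auto simp: nth_append nth_Cons' min_def numeral_2_eq_2 numeral_3_eq_3 Suc_diff_Suc)
  have t': "t' ! k = (if k \<le> i then t ! k
      else if k = Suc i then t ! Suc i - h ! i / 2 else t ! (k - 1))"
    if "k \<le> n" for k
    using sub_eqs i that aleph_lengths
    by (auto simp: nth_append nth_Cons' min_def numeral_2_eq_2 numeral_3_eq_3 Suc_diff_Suc)
  have \<rho>': "\<rho>' ! k = (if k \<le> i then \<rho> ! k
      else if k \<le> Suc (Suc i) then \<rho> ! Suc i / 4 else \<rho> ! (k - 1))"
    if "k \<le> Suc n" for k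
    using sub_eqs i that aleph_lengths
    by (auto simp: nth_append nth_Cons' min_def numeral_2_eq_2 numeral_3_eq_3 Suc_diff_Suc)
  define f where "f k = cost_term L dR dF (v (t ! k)) (h ! k) (\<rho> ! k) (\<rho> ! Suc k)" for k
  define g where "g k = cost_term L dR dF (v (t' ! k)) (h' ! k) (\<rho>' ! k) (\<rho>' ! Suc k)" for k
  have pos: "0 < \<rho> ! Suc i"
    using aleph_rho_pos i by simp
  have "(\<Sum>k<n. f k) + g (Suc i) \<le> (\<Sum>k<Suc n. g k)"
  proof (rule sum_insert_index_le[OF i])
    fix k assume k: "k \<le> i"
    show "f k \<le> g k"
    proof (cases "k = i")
      case True
      have "f i \<le> cost_term L dR dF (v (t ! i)) (h ! i / 2) (\<rho> ! i) (\<rho> ! Suc i / 4)"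
        unfolding f_def using i aleph_t_mem[of i] aleph_h_pos aleph_Lh pos min
        by (intro cost_term_halve_ge v) auto
      also have "\<dots> = g i"
        using i by (simp add: g_def h' t' \<rho>')
      finally show ?thesis
        using True by simp
    next
      case False
      then show ?thesis
        using k i by (simp add: f_def g_def h' t' \<rho>')
    qed
  next
    fix k assume k: "i < k" "k < n"
    show "f k \<le> g (Suc k)"
    proof (cases "k = Suc i")
      case True
      \<comment> \<open>The interval to the right of node \<open>Suc i\<close>, present only if
        \<open>Suc i < n\<close>; its left node carries the quartered value.\<close>
      have f_nonneg: "0 \<le> f k"
        unfolding f_def using k aleph_t_mem[of k] aleph_h_pos aleph_Lh aleph_rho_pos
        by (intro less_imp_le[OF cost_term_pos] v) auto
      have le: "\<rho> ! Suc i \<le> \<rho> ! Suc k"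
        using min k by simp
      have "f k \<le> 4 ^ (dR + dF) * f k"
        using mult_right_mono[OF _ f_nonneg, of 1 "4 ^ (dR + dF)"] by simp
      also have "\<dots> = g (Suc k)"
        using True k pos le
          cost_term_quarter[of "\<rho> ! k" "\<rho> ! Suc k" "\<rho> ! Suc k" L dR dF "v (t ! k)" "h ! k"]
        by (simp add: f_def g_def h' t' \<rho>')
      finally show ?thesis .
    next
      case False
      then show ?thesis
        using k by (simp add: f_def g_def h' t' \<rho>')
    qed
  qed
  moreover have "delta_cost L dR dF (h, t, \<rho>) v (Suc i) = (\<Sum>k<Suc n. g k) - (\<Sum>k<n. f k)"
    unfolding delta_cost_def sub cost_eq_sum_cost_term f_def g_def len aleph_lengths(1) ..
  moreover have "g (Suc i) = cost_term L dR dF (v (t ! Suc i - h ! i / 2)) (h ! i / 2)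
      (\<rho> ! Suc i / 4) (\<rho> ! Suc i / 4)"
    using i by (simp add: g_def h' t' \<rho>')
  ultimately show ?thesis
    by simp
qed

lemma delta_cost_argmin_ge:
  fixes v :: "real \<Rightarrow> real"
  assumes P: "0 < P" and n: "1 \<le> n" and dR: "1 \<le> dR" and m: "0 < m"
    and v: "\<And>s. s \<in> {0..T} \<Longrightarrow> m \<le> v s"
    and k: "k \<le> n" and argmin: "\<rho> ! k = Min (set \<rho>)"
  shows "m * (2 * L * P) powr (- real dF / 2) * (\<rho> ! k) powr (- real dR - real dF / 2)
           \<le> delta_cost L dR dF (h, t, \<rho>) v k"
proof -
  have min: "\<rho> ! k \<le> \<rho> ! j" if "j \<le> n" for j
    unfolding argmin using that aleph_lengths by (intro Min_le) auto
  have v_pos: "0 < v s" if "s \<in> {0..T}" for s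
    using v[OF that] m by linarith
  have K: "0 < 2 * L * P"
    using L P by simp
  have r: "0 < \<rho> ! k"
    using aleph_rho_pos k .
  show ?thesis
  proof (cases k)
    case 0
    \<comment> \<open>No equation ties \<open>\<rho> ! 0\<close> to \<open>h ! 0\<close>, but
      minimality gives \<open>\<rho> ! 0 \<le> \<rho> ! 1\<close>, and \<open>\<rho> ! 1\<close>
      equals \<open>2 * L * P * (h ! 0)\<^sup>2\<close>.\<close>
    have "m * (2 * L * P) powr (- real dF / 2) * (\<rho> ! 0) powr (- real dR - real dF / 2)
        \<le> cost_term L dR dF (v (t ! 0)) (h ! 0) (\<rho> ! 0) (\<rho> ! 1)"
      using 0 n m K r v aleph_t_mem[of 0] aleph_h_pos aleph_Lh aleph_rho_Suc[of 0] min[of 1]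
      by (intro cost_term_lower_bound) auto
    also have "\<dots> \<le> delta_cost L dR dF (h, t, \<rho>) v 0"
      using 0 n dR v_pos aleph_t_mem[of 0] min[of 1] by (intro delta_cost_zero_ge) auto
    finally show ?thesis
      using 0 by simp
  next
    case (Suc i)
    have i: "i < n"
      using k Suc by simp
    \<comment> \<open>The exponent is negative, so passing to the quartered value only
      helps.\<close>
    have "(\<rho> ! k) powr (- real dR - real dF / 2)
        \<le> (\<rho> ! k / 4) powr (- real dR - real dF / 2)"
      using r by (intro powr_mono2') auto
    then have "m * (2 * L * P) powr (- real dF / 2) * (\<rho> ! k) powr (- real dR - real dF / 2)
        \<le> m * (2 * L * P) powr (- real dF / 2) *
            (\<rho> ! k / 4) powr (- real dR - real dF / 2)"
      using m by (intro mult_left_mono) auto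
    \<comment> \<open>Halving \<open>h\<close> and quartering \<open>\<rho>\<close> preserves
      \<open>\<rho> = 2 * L * P * h\<^sup>2\<close>.\<close>
    also have "\<dots> \<le> cost_term L dR dF (v (t ! Suc i - h ! i / 2)) (h ! i / 2)
        (\<rho> ! k / 4) (\<rho> ! k / 4)"
      using m K r i aleph_h_pos aleph_Lh[of i] aleph_rho_Suc[of i] Suc
      by (intro cost_term_lower_bound v aleph_midpoint_mem) (auto simp: power_divide)
    also have "\<dots> \<le> delta_cost L dR dF (h, t, \<rho>) v k"
      using i v_pos min delta_cost_Suc_ge[of i v] Suc by simp
    finally show ?thesis .
  qed
qed

end

theorem lemma6p5:
  fixes L P T :: real and dR dF :: nat and v :: "real \<Rightarrow> real"
  assumes "L > 0" and "P > 0" and "T > 0"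
    and "dR \<ge> 1"
    and "continuous_on {0..T} v"
    and "\<forall>s\<in>{0..T}. v s > 0"
  shows "(\<exists>c>0. \<forall>n\<ge>1. \<forall>h t \<rho>. (h, t, \<rho>) \<in> aleph L P T n \<longrightarrow>
            (\<forall>k\<in>{0..n}. \<rho> ! k = Min (set \<rho>) \<longrightarrow>
               c * Min (set \<rho>) powr (- real dR - real dF / 2)
                 \<le> delta_cost L dR dF (h, t, \<rho>) v k))
       \<and> (\<forall>n\<ge>1. \<forall>h t \<rho>. (h, t, \<rho>) \<in> aleph L P T n \<longrightarrow>
            (\<forall>k\<in>{0..n}. \<rho> ! k = Min (set \<rho>) \<longrightarrow>
               delta_cost L dR dF (h, t, \<rho>) v k > 0))"
proof -
  \<comment> \<open>Compactness yields a positive lower bound of \<open>v\<close> that is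
    independent of the discretization, which makes \<open>c\<close> uniform.\<close>
  have "compact {0..T}" "{0..T} \<noteq> {}"
    using assms(3) by auto
  then obtain s where s: "s \<in> {0..T}" "\<And>x. x \<in> {0..T} \<Longrightarrow> v s \<le> v x"
    using continuous_attains_inf[OF _ _ assms(5)] by blast
  have m: "0 < v s"
    using assms(6) s by blast
  define c where "c = v s * (2 * L * P) powr (- real dF / 2)"
  have c: "0 < c"
    using m assms(1,2) by (simp add: c_def)
  have bound: "c * Min (set \<rho>) powr (- real dR - real dF / 2)
        \<le> delta_cost L dR dF (h, t, \<rho>) v k"
    if "1 \<le> n" "(h, t, \<rho>) \<in> aleph L P T n" "k \<in> {0..n}" "\<rho> ! k = Min (set \<rho>)"
    for n h t \<rho> k
    using delta_cost_argmin_ge[OF assms(1) that(2) assms(2) that(1) assms(4) m s(2)]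
      that(3,4) by (simp add: c_def)
  have pos: "0 < delta_cost L dR dF (h, t, \<rho>) v k"
    if "1 \<le> n" "(h, t, \<rho>) \<in> aleph L P T n" "k \<in> {0..n}" "\<rho> ! k = Min (set \<rho>)"
    for n h t \<rho> k
  proof -
    have "0 < Min (set \<rho>)"
      using aleph_rho_pos[OF assms(1) that(2), of k] that(3,4) by simp
    then have "0 < c * Min (set \<rho>) powr (- real dR - real dF / 2)"
      using c by simp
    also have "\<dots> \<le> delta_cost L dR dF (h, t, \<rho>) v k"
      by (rule bound[OF that])
    finally show ?thesis .
  qed
  show ?thesis
    using c bound pos by blast
qed

end
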